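(* Let $(R,+,\cdot)$ be a finite additively idempotent semiring with zero and one such that the semigroup $(R,+)$ is irreducible, let $I$ be a finite index set, and let $A\in \mathrm{Mat}_{I\times I}(R)$. Then $A$ is invertible if and only if $A$ is a generalized permutation matrix.
   Context: A semiring $(R,+,\cdot)$ consists of a nonempty set $R$ with a commutative semigroup $(R,+)$ and a semigroup $(R,\cdot)$ satisfying both distributive laws. A zero is a neutral element $0$ of $(R,+)$ with $0\cdot x=x\cdot 0=0$ for all $x$; a one is a neutral element of $(R,\cdot)$. Additively idempotent means $r+r=r$ for all $r\in R$. An algebra (here the semigroup $(R,+)$) is called irreducible if it has more than one element and is not isomorphic to a direct product of two algebras (semigroups) each having more than one element. $\mathrm{Mat}_{I\times I}(R)$ is the semiring of $I\times I$ matrices over $R$ with the usual addition and multiplication; a matrix is invertible if it has a two-sided multiplicative inverse in it. A generalized permutation matrix is a matrix in which each row and each column has exactly one nonzero entry and this nonzero entry is invertible in $(R,\cdot)$. *)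

theory Defs
  imports "HOL-Algebra.Algebra"
begin

text \<open>
  HOL-Algebra has no separate record of semigroups. We use its monoid records and ignore the
  field \<open>one\<close>; the library's \<open>\<cong>\<close> and the carrier and multiplication of \<open>\<times>\<times>\<close> do not refer to it.
\<close>

definition semigroup_struct :: "('a, 'm) monoid_scheme \<Rightarrow> bool" where
  "semigroup_struct G \<longleftrightarrow>
     (\<forall>x\<in>carrier G. \<forall>y\<in>carrier G. x \<otimes>\<^bsub>G\<^esub> y \<in> carrier G) \<and>
     (\<forall>x\<in>carrier G. \<forall>y\<in>carrier G. \<forall>z\<in>carrier G.
        (x \<otimes>\<^bsub>G\<^esub> y) \<otimes>\<^bsub>G\<^esub> z = x \<otimes>\<^bsub>G\<^esub> (y \<otimes>\<^bsub>G\<^esub> z))"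

definition nontrivial_struct :: "('a, 'm) monoid_scheme \<Rightarrow> bool" where
  "nontrivial_struct G \<longleftrightarrow> (\<exists>x\<in>carrier G. \<exists>y\<in>carrier G. x \<noteq> y)"

text \<open>
  The factors range over semigroups carried by arbitrary subsets of the element type of \<open>G\<close>. This
  is no restriction: nonempty \<open>S\<close> and \<open>T\<close> inject into \<open>S \<times> T\<close>, so if \<open>G\<close> is isomorphic to
  \<open>S \<times>\<times> T\<close>, both factors have isomorphic copies with carriers inside the carrier of \<open>G\<close>.
\<close>

definition irreducible_semigroup :: "('a, 'm) monoid_scheme \<Rightarrow> bool" where
  "irreducible_semigroup G \<longleftrightarrow>
     nontrivial_struct G \<and>
     \<not> (\<exists>(S :: 'a monoid) (T :: 'a monoid).
          semigroup_struct S \<and> nontrivial_struct S \<and>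
          semigroup_struct T \<and> nontrivial_struct T \<and>
          G \<cong> S \<times>\<times> T)"

text \<open>
  Matrices are extensional functions on \<open>I \<times> I\<close>, so that equality in the carrier is equality of
  all entries. The product is meant for finite \<open>I\<close> only, since \<open>finsum\<close> over an infinite index set
  takes a default value.
\<close>

definition Mat :: "'i set \<Rightarrow> ('a, 'm) ring_scheme \<Rightarrow> ('i \<times> 'i \<Rightarrow> 'a) ring" where
  "Mat I R =
     \<lparr>carrier = I \<times> I \<rightarrow>\<^sub>E carrier R,
      monoid.mult = (\<lambda>A B. \<lambda>(i, j)\<in>I \<times> I. \<Oplus>\<^bsub>R\<^esub>k\<in>I. A (i, k) \<otimes>\<^bsub>R\<^esub> B (k, j)),
      one = (\<lambda>(i, j)\<in>I \<times> I. if i = j then \<one>\<^bsub>R\<^esub> else \<zero>\<^bsub>R\<^esub>),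
      ring.zero = (\<lambda>(i, j)\<in>I \<times> I. \<zero>\<^bsub>R\<^esub>),
      add = (\<lambda>A B. \<lambda>(i, j)\<in>I \<times> I. A (i, j) \<oplus>\<^bsub>R\<^esub> B (i, j))\<rparr>"

definition generalized_permutation_matrix ::
    "'i set \<Rightarrow> ('a, 'm) ring_scheme \<Rightarrow> ('i \<times> 'i \<Rightarrow> 'a) \<Rightarrow> bool" where
  "generalized_permutation_matrix I R A \<longleftrightarrow>
     A \<in> carrier (Mat I R) \<and>
     (\<forall>i\<in>I. \<exists>!j. j \<in> I \<and> A (i, j) \<noteq> \<zero>\<^bsub>R\<^esub>) \<and>
     (\<forall>j\<in>I. \<exists>!i. i \<in> I \<and> A (i, j) \<noteq> \<zero>\<^bsub>R\<^esub>) \<and>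
     (\<forall>i\<in>I. \<forall>j\<in>I. A (i, j) \<noteq> \<zero>\<^bsub>R\<^esub> \<longrightarrow> A (i, j) \<in> Units R)"

end

theory Submission
  imports Defs
begin

text \<open>
  If \<open>B\<close> is inverse to \<open>A\<close>, then sums with a zero value have only zero summands, because addition
  is idempotent; hence for fixed \<open>i\<close> the products \<open>A (i, k) \<otimes> B (k, i)\<close> are pairwise orthogonal
  and sum up to \<open>\<one>\<close>. An orthogonal decomposition \<open>\<one> = e \<oplus> f\<close> splits the additive semigroup as
  \<open>R e \<times> R f\<close>, so irreducibility forces one of these products to be \<open>\<one>\<close>. The same holds for
  \<open>B (k, i) \<otimes> A (i, k)\<close>, which makes \<open>A (i, k)\<close> a unit, and orthogonality kills
  the other entries in its row and column.
\<close>

context semiring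
begin

section \<open>Zero sums under idempotent addition\<close>

text \<open>Writing the neutral element in \<open>x = x \<oplus> \<zero>\<close> as
  \<open>x \<oplus> y\<close> lets \<open>x \<oplus> x\<close> collapse to \<open>x\<close>.\<close>

lemma idem_sum_eq_zeroD:
  assumes idem: "\<And>r. r \<in> carrier R \<Longrightarrow> r \<oplus> r = r"
    and "x \<in> carrier R" "y \<in> carrier R" "x \<oplus> y = \<zero>"
  shows "x = \<zero>"
proof -
  have "x = x \<oplus> (x \<oplus> y)"
    using assms by simp
  also have "\<dots> = (x \<oplus> x) \<oplus> y"
    using assms(2,3) by (simp add: a_assoc)
  also have "\<dots> = \<zero>"
    using assms by simp
  finally show ?thesis .
qed

lemma idem_finsum_eq_zeroD:
  assumes idem: "\<And>r. r \<in> carrier R \<Longrightarrow> r \<oplus> r = r"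
    and "finite K" "c \<in> K \<rightarrow> carrier R" "finsum R c K = \<zero>" "k \<in> K"
  shows "c k = \<zero>"
proof -
  have ck: "c k \<in> carrier R" and rest: "finsum R c (K - {k}) \<in> carrier R"
    using assms(3,5) by (auto intro!: finsum_closed)
  have "finsum R c K = c k \<oplus> finsum R c (K - {k})"
    using assms(2,3,5) finsum_insert[of "K - {k}" k c] by (auto simp: insert_absorb Pi_iff)
  then show ?thesis
    using idem_sum_eq_zeroD[OF idem ck rest] \<open>finsum R c K = \<zero>\<close> by metis
qed

section \<open>Orthogonal decompositions of \<open>\<one>\<close> and irreducibility\<close>

lemma irreducible_one_neq_zero:
  assumes "irreducible_semigroup (add_monoid R)"
  shows "\<one> \<noteq> \<zero>"
proof
  assume "\<one> = \<zero>"
  then have "x = \<zero>" if "x \<in> carrier R" for x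
    using that by (metis l_one l_null)
  moreover have "\<exists>x\<in>carrier R. \<exists>y\<in>carrier R. x \<noteq> y"
    using assms by (simp add: irreducible_semigroup_def nontrivial_struct_def)
  ultimately show False
    by metis
qed

text \<open>The map \<open>r \<mapsto> (r \<otimes> e, r \<otimes> f)\<close> has addition of the
  components as its inverse. Only the additive structure has to split, so left ideals serve as
  factors; both are nontrivial if \<open>e\<close> and \<open>f\<close> are nonzero.\<close>

lemma irreducible_orthogonal_pair:
  assumes irr: "irreducible_semigroup (add_monoid R)"
    and e[simp]: "e \<in> carrier R" and f[simp]: "f \<in> carrier R"
    and ef: "e \<otimes> f = \<zero>" "f \<otimes> e = \<zero>" and one: "e \<oplus> f = \<one>"
  shows "e = \<zero> \<or> f = \<zero>"
proof (rule ccontr)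
  assume "\<not> ?thesis"
  then have nz: "e \<noteq> \<zero>" "f \<noteq> \<zero>" by auto
  \<comment> \<open>Multiplying \<open>e \<oplus> f = \<one>\<close> by \<open>e\<close> from the
    left leaves only \<open>e \<otimes> e\<close>, by orthogonality.\<close>
  have ee: "e \<otimes> e = e"
    using r_distr[OF e f e] ef(1) one by simp
  have ff: "f \<otimes> f = f"
    using r_distr[OF e f f] ef(2) one by simp
  \<comment> \<open>The left ideal generated by \<open>g\<close>, with the addition of
    \<open>R\<close> as its operation.\<close>
  define S where "S g = \<lparr>carrier = (\<lambda>r. r \<otimes> g) ` carrier R, monoid.mult = add R, one = \<zero>\<rparr>" for g
  have semi: "semigroup_struct (S g)" if "g \<in> carrier R" for g
    using that
    by (auto simp: semigroup_struct_def S_def a_assoc simp flip: l_distr)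
  have nontriv: "nontrivial_struct (S g)" if "g \<in> carrier R" "g \<noteq> \<zero>" for g
  proof -
    have "\<one> \<otimes> g \<in> carrier (S g)" "\<zero> \<otimes> g \<in> carrier (S g)"
      by (auto simp: S_def)
    then show ?thesis
      using that by (auto simp: nontrivial_struct_def)
  qed
  let ?h = "\<lambda>r. (r \<otimes> e, r \<otimes> f)"
  have split: "r \<otimes> e \<oplus> r \<otimes> f = r" if "r \<in> carrier R" for r
    using r_distr[OF e f that] one that by simp
  have "?h \<in> hom (add_monoid R) (S e \<times>\<times> S f)"
    by (auto simp: hom_def DirProd_def S_def l_distr)
  moreover have "inj_on ?h (carrier R)"
    by (rule inj_on_inverseI[where g = "\<lambda>(x, y). x \<oplus> y"]) (simp add: split)
  moreover have "?h ` carrier R = carrier (S e \<times>\<times> S f)"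
  proof -
    have "(x \<otimes> e, y \<otimes> f) \<in> ?h ` carrier R" if "x \<in> carrier R" "y \<in> carrier R" for x y
    proof (rule image_eqI)
      \<comment> \<open>The preimage of a pair is its sum: multiplication by \<open>e\<close> fixes
        \<open>x \<otimes> e\<close> and annihilates \<open>y \<otimes> f\<close>, and symmetrically
        for \<open>f\<close>.\<close>
      show "(x \<otimes> e, y \<otimes> f) = ?h (x \<otimes> e \<oplus> y \<otimes> f)"
        using that by (simp add: l_distr m_assoc ee ff ef)
    qed (use that in simp)
    then show ?thesis
      unfolding DirProd_def S_def by auto
  qed
  ultimately have "?h \<in> iso (add_monoid R) (S e \<times>\<times> S f)"
    by (auto simp: iso_def bij_betw_def)
  then have "add_monoid R \<cong> S e \<times>\<times> S f"
    by (auto simp: is_iso_def)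
  moreover have "semigroup_struct (S e)" "semigroup_struct (S f)"
    "nontrivial_struct (S e)" "nontrivial_struct (S f)"
    using semi nontriv nz by simp_all
  ultimately show False
    using irr unfolding irreducible_semigroup_def by blast
qed

text \<open>Some \<open>c k\<close> is nonzero, since the sum is not \<open>\<zero>\<close>. By
  distributivity the sum of all other members is orthogonal to it, so the case of two summands
  forces that sum to vanish.\<close>

lemma irreducible_orthogonal_family:
  assumes irr: "irreducible_semigroup (add_monoid R)"
    and "finite K" and c: "c \<in> K \<rightarrow> carrier R"
    and orth: "\<And>k l. \<lbrakk>k \<in> K; l \<in> K; k \<noteq> l\<rbrakk> \<Longrightarrow> c k \<otimes> c l = \<zero>"
    and one: "finsum R c K = \<one>"
  shows "\<exists>k\<in>K. c k = \<one>"
proof -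
  obtain k where k: "k \<in> K" "c k \<noteq> \<zero>"
    using one irreducible_one_neq_zero[OF irr] add.finprod_one_eqI[of K c] by auto
  have ck: "c k \<in> carrier R" and c': "c \<in> K - {k} \<rightarrow> carrier R"
    using c k by auto
  let ?f = "finsum R c (K - {k})"
  have sum: "c k \<oplus> ?f = \<one>"
    using finsum_insert[of "K - {k}" k c] \<open>finite K\<close> k ck c' one by (auto simp: insert_absorb)
  have "c k \<otimes> ?f = finsum R (\<lambda>l. c k \<otimes> c l) (K - {k})"
    using finsum_rdistr[of "K - {k}" "c k" c] \<open>finite K\<close> ck c' by auto
  also have "\<dots> = \<zero>"
    using orth k by (intro add.finprod_one_eqI) auto
  finally have 1: "c k \<otimes> ?f = \<zero>" .
  have "?f \<otimes> c k = finsum R (\<lambda>l. c l \<otimes> c k) (K - {k})"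
    using finsum_ldistr[of "K - {k}" "c k" c] \<open>finite K\<close> ck c' by auto
  also have "\<dots> = \<zero>"
    using orth k by (intro add.finprod_one_eqI) auto
  finally have 2: "?f \<otimes> c k = \<zero>" .
  have "?f = \<zero>"
    using irreducible_orthogonal_pair[OF irr ck _ 1 2 sum] c' k by auto
  then show ?thesis
    using sum ck k by auto
qed

section \<open>Entries of mutually inverse matrices\<close>

lemma Mat_mult_one_entry:
  assumes "A \<otimes>\<^bsub>Mat I R\<^esub> B = \<one>\<^bsub>Mat I R\<^esub>" "i \<in> I" "j \<in> I"
  shows "(\<Oplus>k\<in>I. A (i, k) \<otimes> B (k, j)) = (if i = j then \<one> else \<zero>)"
  using fun_cong[OF assms(1), of "(i, j)"] assms(2,3) by (simp add: Mat_def)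

lemma Mat_mult_one_off_diagonal:
  assumes idem: "\<And>r. r \<in> carrier R \<Longrightarrow> r \<oplus> r = r"
    and "finite I" and A: "A \<in> carrier (Mat I R)" and B: "B \<in> carrier (Mat I R)"
    and AB: "A \<otimes>\<^bsub>Mat I R\<^esub> B = \<one>\<^bsub>Mat I R\<^esub>"
    and ij: "i \<in> I" "j \<in> I" "k \<in> I" "i \<noteq> j"
  shows "A (i, k) \<otimes> B (k, j) = \<zero>"
proof -
  have "(\<lambda>k. A (i, k) \<otimes> B (k, j)) \<in> I \<rightarrow> carrier R"
    using A B ij by (auto simp: Mat_def)
  then show ?thesis
    using idem_finsum_eq_zeroD[OF idem \<open>finite I\<close>] Mat_mult_one_entry[OF AB ij(1,2)] ij by auto
qed

lemma Mat_inverse_row_pivot: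
  assumes irr: "irreducible_semigroup (add_monoid R)"
    and idem: "\<And>r. r \<in> carrier R \<Longrightarrow> r \<oplus> r = r"
    and fin: "finite I" and A: "A \<in> carrier (Mat I R)" and B: "B \<in> carrier (Mat I R)"
    and AB: "A \<otimes>\<^bsub>Mat I R\<^esub> B = \<one>\<^bsub>Mat I R\<^esub>" and BA: "B \<otimes>\<^bsub>Mat I R\<^esub> A = \<one>\<^bsub>Mat I R\<^esub>"
    and i: "i \<in> I"
  shows "\<exists>k\<in>I. A (i, k) \<otimes> B (k, i) = \<one>"
proof (rule irreducible_orthogonal_family[OF irr fin])
  have cA: "A (i, k) \<in> carrier R" and cB: "B (k, i) \<in> carrier R" if "k \<in> I" for k
    using A B i that by (auto simp: Mat_def)
  show "(\<lambda>k. A (i, k) \<otimes> B (k, i)) \<in> I \<rightarrow> carrier R"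
    using cA cB by auto
  show "(\<Oplus>k\<in>I. A (i, k) \<otimes> B (k, i)) = \<one>"
    using Mat_mult_one_entry[OF AB i i] by simp
  fix k l assume kl: "k \<in> I" "l \<in> I" "k \<noteq> l"
  \<comment> \<open>After regrouping, the middle factor is a summand of the off-diagonal entry
    \<open>(k, l)\<close> of the product of \<open>B\<close> and \<open>A\<close>.\<close>
  have "A (i, k) \<otimes> B (k, i) \<otimes> (A (i, l) \<otimes> B (l, i))
      = A (i, k) \<otimes> (B (k, i) \<otimes> A (i, l)) \<otimes> B (l, i)"
    using cA cB kl by (simp add: m_assoc)
  also have "\<dots> = \<zero>"
    using Mat_mult_one_off_diagonal[OF idem fin B A BA, of k l i] kl i cA cB by simp
  finally show "A (i, k) \<otimes> B (k, i) \<otimes> (A (i, l) \<otimes> B (l, i)) = \<zero>" .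
qed

text \<open>A pivot for row \<open>i\<close> of \<open>A\<close> gives only a right inverse of
  \<open>A (i, k)\<close>. A second pivot, for row \<open>k\<close> of \<open>B\<close>, supplies
  the left inverse once its index \<open>j\<close> is identified with \<open>i\<close>.\<close>

lemma Mat_inverse_row:
  assumes irr: "irreducible_semigroup (add_monoid R)"
    and idem: "\<And>r. r \<in> carrier R \<Longrightarrow> r \<oplus> r = r"
    and fin: "finite I" and A: "A \<in> carrier (Mat I R)" and B: "B \<in> carrier (Mat I R)"
    and AB: "A \<otimes>\<^bsub>Mat I R\<^esub> B = \<one>\<^bsub>Mat I R\<^esub>" and BA: "B \<otimes>\<^bsub>Mat I R\<^esub> A = \<one>\<^bsub>Mat I R\<^esub>"
    and i: "i \<in> I"
  obtains k where "k \<in> I" "A (i, k) \<otimes> B (k, i) = \<one>" "B (k, i) \<otimes> A (i, k) = \<one>"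
    "\<And>l. \<lbrakk>l \<in> I; l \<noteq> k\<rbrakk> \<Longrightarrow> A (i, l) = \<zero>"
    "\<And>l. \<lbrakk>l \<in> I; l \<noteq> i\<rbrakk> \<Longrightarrow> A (l, k) = \<zero>"
proof -
  have cA: "A (j, k) \<in> carrier R" and cB: "B (j, k) \<in> carrier R" if "j \<in> I" "k \<in> I" for j k
    using A B that by (auto simp: Mat_def)
  note offA = Mat_mult_one_off_diagonal[OF idem fin A B AB]
  note offB = Mat_mult_one_off_diagonal[OF idem fin B A BA]
  obtain k where k: "k \<in> I" and ab: "A (i, k) \<otimes> B (k, i) = \<one>"
    using Mat_inverse_row_pivot[OF irr idem fin A B AB BA i] by auto
  obtain j where j: "j \<in> I" and ba: "B (k, j) \<otimes> A (j, k) = \<one>"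
    using Mat_inverse_row_pivot[OF irr idem fin B A BA AB k] by auto
  have "j = i"
  proof (rule ccontr)
    assume "j \<noteq> i"
    \<comment> \<open>The second pivot product is inserted into the first; regrouping exposes
      \<open>A (i, k) \<otimes> B (k, j)\<close>, an off-diagonal summand.\<close>
    have "\<one> = A (i, k) \<otimes> (B (k, j) \<otimes> A (j, k)) \<otimes> B (k, i)"
      using ab ba cA i k by simp
    also have "\<dots> = (A (i, k) \<otimes> B (k, j)) \<otimes> (A (j, k) \<otimes> B (k, i))"
      using cA cB i j k by (simp add: m_assoc)
    also have "\<dots> = \<zero>"
      using offA[of i j k] \<open>j \<noteq> i\<close> cA cB i j k by simp
    finally show False
      using irreducible_one_neq_zero[OF irr] by simp
  qed
  have row: "A (i, l) = \<zero>" if "l \<in> I" "l \<noteq> k" for l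
  proof -
    \<comment> \<open>Multiplication by \<open>\<one> = A (i, k) \<otimes> B (k, i)\<close> from the
      left produces an off-diagonal summand of the product of \<open>B\<close> and
      \<open>A\<close>.\<close>
    have "A (i, l) = A (i, k) \<otimes> (B (k, i) \<otimes> A (i, l))"
      using ab cA cB i k that by (simp flip: m_assoc)
    then show ?thesis
      using offB[of k l i] that cA i k by simp
  qed
  have col: "A (l, k) = \<zero>" if "l \<in> I" "l \<noteq> i" for l
  proof -
    have "A (l, k) = (A (l, k) \<otimes> B (k, i)) \<otimes> A (i, k)"
      using ba \<open>j = i\<close> cA cB i k that by (simp add: m_assoc)
    then show ?thesis
      using offA[of l i k] that cA i k by simp
  qed
  show ?thesis
    using that k ab ba \<open>j = i\<close> row col by blast
qed

lemma Mat_Units_imp_generalized_permutation_matrix: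
  assumes irr: "irreducible_semigroup (add_monoid R)"
    and idem: "\<And>r. r \<in> carrier R \<Longrightarrow> r \<oplus> r = r"
    and fin: "finite I" and "A \<in> Units (Mat I R)"
  shows "generalized_permutation_matrix I R A"
proof -
  obtain B where A: "A \<in> carrier (Mat I R)" and B: "B \<in> carrier (Mat I R)"
    and AB: "A \<otimes>\<^bsub>Mat I R\<^esub> B = \<one>\<^bsub>Mat I R\<^esub>" and BA: "B \<otimes>\<^bsub>Mat I R\<^esub> A = \<one>\<^bsub>Mat I R\<^esub>"
    using assms(4) by (auto simp: Units_def)
  have cA: "A (j, k) \<in> carrier R" and cB: "B (j, k) \<in> carrier R" if "j \<in> I" "k \<in> I" for j k
    using A B that by (auto simp: Mat_def)
  note one_zero = irreducible_one_neq_zero[OF irr]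
  have row: "\<exists>k\<in>I. A (i, k) \<noteq> \<zero> \<and> A (i, k) \<in> Units R \<and> (\<forall>l\<in>I. l \<noteq> k \<longrightarrow> A (i, l) = \<zero>)"
    if i: "i \<in> I" for i
  proof -
    obtain k where k: "k \<in> I" "A (i, k) \<otimes> B (k, i) = \<one>" "B (k, i) \<otimes> A (i, k) = \<one>"
      "\<And>l. \<lbrakk>l \<in> I; l \<noteq> k\<rbrakk> \<Longrightarrow> A (i, l) = \<zero>"
      using Mat_inverse_row[OF irr idem fin A B AB BA i] by metis
    have "A (i, k) \<noteq> \<zero>" "A (i, k) \<in> Units R"
      using k cA cB i one_zero by (auto simp: Units_def)
    then show ?thesis
      using k by auto
  qed
  have col: "\<exists>i\<in>I. A (i, k) \<noteq> \<zero> \<and> (\<forall>l\<in>I. l \<noteq> i \<longrightarrow> A (l, k) = \<zero>)" if k: "k \<in> I" for k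
  proof -
    obtain i where i: "i \<in> I" "B (k, i) \<otimes> A (i, k) = \<one>"
      using Mat_inverse_row_pivot[OF irr idem fin B A BA AB k] by auto
    then have nz: "A (i, k) \<noteq> \<zero>"
      using cB k one_zero by auto
    \<comment> \<open>Row \<open>i\<close> has a pivot column \<open>k'\<close> of its own. It must
      be \<open>k\<close>, because \<open>A (i, k)\<close> is nonzero while row \<open>i\<close>
      vanishes outside \<open>k'\<close>.\<close>
    moreover obtain k' where k': "k' \<in> I" "\<And>l. \<lbrakk>l \<in> I; l \<noteq> k'\<rbrakk> \<Longrightarrow> A (i, l) = \<zero>"
      "\<And>l. \<lbrakk>l \<in> I; l \<noteq> i\<rbrakk> \<Longrightarrow> A (l, k') = \<zero>"
      using Mat_inverse_row[OF irr idem fin A B AB BA \<open>i \<in> I\<close>] by metis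
    moreover have "k' = k"
      using nz k k' by metis
    ultimately show ?thesis
      using i by auto
  qed
  show ?thesis
    unfolding generalized_permutation_matrix_def
  proof (intro conjI ballI impI)
    show "\<exists>!j. j \<in> I \<and> A (i, j) \<noteq> \<zero>" if "i \<in> I" for i
      using row[OF that] by metis
    show "\<exists>!i. i \<in> I \<and> A (i, j) \<noteq> \<zero>" if "j \<in> I" for j
      using col[OF that] by metis
    show "A (i, j) \<in> Units R" if "i \<in> I" "j \<in> I" "A (i, j) \<noteq> \<zero>" for i j
      using row[OF that(1)] that by metis
  qed (rule A)
qed

section \<open>Inverting generalized permutation matrices\<close>

lemma finsum_only:
  assumes "finite K" "k \<in> K" "c k \<in> carrier R" "\<And>l. \<lbrakk>l \<in> K; l \<noteq> k\<rbrakk> \<Longrightarrow> c l = \<zero>"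
  shows "finsum R c K = c k"
proof -
  have c: "c \<in> K \<rightarrow> carrier R"
    using assms by (metis Pi_I zero_closed)
  have "finsum R c K = finsum R (\<lambda>l. if k = l then c l else \<zero>) K"
    using assms by (intro finsum_cong') auto
  also have "\<dots> = c k"
    using assms c by (intro finsum_singleton)
  finally show ?thesis .
qed

lemma generalized_permutation_matrix_imp_Mat_Units:
  assumes fin: "finite I" and gp: "generalized_permutation_matrix I R A"
  shows "A \<in> Units (Mat I R)"
proof -
  have A: "A \<in> carrier (Mat I R)"
    and row: "\<And>i. i \<in> I \<Longrightarrow> \<exists>!j. j \<in> I \<and> A (i, j) \<noteq> \<zero>"
    and col: "\<And>j. j \<in> I \<Longrightarrow> \<exists>!i. i \<in> I \<and> A (i, j) \<noteq> \<zero>"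
    and unit: "\<And>i j. \<lbrakk>i \<in> I; j \<in> I; A (i, j) \<noteq> \<zero>\<rbrakk> \<Longrightarrow> A (i, j) \<in> Units R"
    using gp by (auto simp: generalized_permutation_matrix_def)
  have cA: "A (j, k) \<in> carrier R" if "j \<in> I" "k \<in> I" for j k
    using A that by (auto simp: Mat_def)
  \<comment> \<open>The transpose of \<open>A\<close> with its nonzero entries inverted. Zero
    entries are kept apart because \<open>inv\<close> has an unspecified value outside the
    units.\<close>
  define B where "B = (\<lambda>(j, i)\<in>I \<times> I. if A (i, j) = \<zero> then \<zero> else inv (A (i, j)))"
  have B_eq: "B (j, i) = (if A (i, j) = \<zero> then \<zero> else inv (A (i, j)))" if "i \<in> I" "j \<in> I" for i j
    using that by (simp add: B_def)
  have cB: "B (j, i) \<in> carrier R" if "i \<in> I" "j \<in> I" for i j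
    using that unit by (auto simp: B_eq)
  have B: "B \<in> carrier (Mat I R)"
    using cB by (auto simp: Mat_def B_def split: if_splits)
  have AB: "(\<Oplus>k\<in>I. A (i, k) \<otimes> B (k, j)) = (if i = j then \<one> else \<zero>)"
    if ij: "i \<in> I" "j \<in> I" for i j
  proof -
    obtain k where k: "k \<in> I" "A (i, k) \<noteq> \<zero>" "\<And>l. \<lbrakk>l \<in> I; l \<noteq> k\<rbrakk> \<Longrightarrow> A (i, l) = \<zero>"
      using row[OF ij(1)] by metis
    have "(\<Oplus>k\<in>I. A (i, k) \<otimes> B (k, j)) = A (i, k) \<otimes> B (k, j)"
      using fin k ij cA cB by (intro finsum_only) auto
    also have "\<dots> = (if i = j then \<one> else \<zero>)"
    proof (cases "i = j")
      case True
      then show ?thesis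
        using k ij unit by (simp add: B_eq)
    next
      case False
      \<comment> \<open>Column \<open>k\<close> already has its nonzero entry in row
        \<open>i\<close>, so \<open>B (k, j)\<close> is \<open>\<zero>\<close> too.\<close>
      then have "A (j, k) = \<zero>"
        using col[OF k(1)] k ij by metis
      then show ?thesis
        using False k ij cA by (simp add: B_eq)
    qed
    finally show ?thesis .
  qed
  have BA: "(\<Oplus>k\<in>I. B (i, k) \<otimes> A (k, j)) = (if i = j then \<one> else \<zero>)"
    if ij: "i \<in> I" "j \<in> I" for i j
  proof -
    \<comment> \<open>Row \<open>i\<close> of \<open>B\<close> comes from column \<open>i\<close> of
      \<open>A\<close>, so the nonzero entry of that column selects the only summand that can
      survive.\<close>
    obtain k where k: "k \<in> I" "A (k, i) \<noteq> \<zero>" "\<And>l. \<lbrakk>l \<in> I; l \<noteq> k\<rbrakk> \<Longrightarrow> A (l, i) = \<zero>"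
      using col[OF ij(1)] by metis
    have "B (i, l) = \<zero>" if "l \<in> I" "l \<noteq> k" for l
      using k(3) that ij by (simp add: B_eq)
    then have "(\<Oplus>k\<in>I. B (i, k) \<otimes> A (k, j)) = B (i, k) \<otimes> A (k, j)"
      using fin k ij cA cB by (intro finsum_only) auto
    also have "\<dots> = (if i = j then \<one> else \<zero>)"
    proof (cases "i = j")
      case True
      then show ?thesis
        using k ij unit by (simp add: B_eq)
    next
      case False
      then have "A (k, j) = \<zero>"
        using row[OF k(1)] k ij by metis
      then show ?thesis
        using False k ij cB by simp
    qed
    finally show ?thesis .
  qed
  have "A \<otimes>\<^bsub>Mat I R\<^esub> B = \<one>\<^bsub>Mat I R\<^esub>" "B \<otimes>\<^bsub>Mat I R\<^esub> A = \<one>\<^bsub>Mat I R\<^esub>"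
    using AB BA by (auto simp: Mat_def fun_eq_iff restrict_def)
  then show ?thesis
    using A B by (auto simp: Units_def)
qed

end

theorem corollary4p8:
  fixes R :: "('a, 'm) ring_scheme" and I :: "'i set" and A :: "'i \<times> 'i \<Rightarrow> 'a"
  assumes "semiring R"
    and "finite (carrier R)"
    and "\<And>r. r \<in> carrier R \<Longrightarrow> r \<oplus>\<^bsub>R\<^esub> r = r"
    and "irreducible_semigroup (add_monoid R)"
    and "finite I"
    and "A \<in> carrier (Mat I R)"
  shows "A \<in> Units (Mat I R) \<longleftrightarrow> generalized_permutation_matrix I R A"
proof -
  interpret semiring R by fact
  show ?thesis
    using Mat_Units_imp_generalized_permutation_matrix[OF assms(4,3,5)]
      generalized_permutation_matrix_imp_Mat_Units[OF assms(5)] by blast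
qed

end
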